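(* Let $D$ be a right-convex divergence on $\mathcal{P}$ such that, for all $P,Q\in\mathcal{P}$, with $R(t)=(Q-P)t+P$, the function $t\mapsto \frac{1}{t}D(P\|R(t))$ is integrable on $[0,1]$ (Lebesgue measure). Then $\Psi^{k}[D]$ is a right-convex divergence for every integer $k\ge 1$, and $\{\Psi^k[D](P\|R(t))\}_{k\ge 0}$ is a monotonically decreasing (i.e. non-increasing) sequence: for all $P,Q\in\mathcal{P}$ and $t\in[0,1]$, $$D(P\|R(t))\geq\Psi[D](P\|R(t))\geq\Psi^{2}[D](P\|R(t))\geq\cdots\geq\Psi^{k}[D](P\|R(t))\geq\cdots\geq 0 .$$ If $P\neq Q$, then for every $k\ge1$ the function $t\mapsto\Psi^{k}[D](P\|R(t))$ is strictly increasing on $[0,1]$.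
   Context: $(\Sigma,\mathcal{M})$ is a measurable space and $\mathcal{P}$ is the set of probability distributions (measures) on it with common support. A divergence is a function $D:\mathcal{P}\times\mathcal{P}\to[0,\infty]$ such that, for all $P,Q\in\mathcal{P}$, $D(P\|Q)\ge 0$, and $D(P\|Q)=0$ if and only if $P=Q$. It is right-convex if it is convex in the second argument: $\lambda D(P\|Q_1)+(1-\lambda)D(P\|Q_2)\ge D(P\|\lambda Q_1+(1-\lambda)Q_2)$ for all $P,Q_1,Q_2\in\mathcal{P}$ and $\lambda\in[0,1]$. For $P,Q\in\mathcal{P}$ and $t\in[0,1]$, $R(t):=(Q-P)t+P\in\mathcal{P}$ denotes the mixture distribution. Integral operator: when $\frac1t D(P\|R(t))$ is integrable on $[0,1]$, define $\Psi[D](P\|R(t)):=\int_0^t\frac1s D(P\|R(s))\,ds$. The right-hand side depends only on $P$ and the distribution $R(t)$, so $\Psi[D]$ is a well-defined function on $\mathcal{P}\times\mathcal{P}$; equivalently, $\Psi[D](P\|Q)=\int_0^1\frac1s D(P\|(Q-P)s+P)\,ds$. Iterates: $\Psi^0$ is the identity operator and $\Psi^{k+1}:=\Psi\circ\Psi^k$ for $k\ge0$. *)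

theory Defs
  imports "HOL-Analysis.Analysis" "HOL-Probability.Probability_Measure"
begin

(* M supplies the measurable space (space M, sets M) and, through its null sets, the common
   support: on a measurable space without topology, two distributions have common support iff
   they are mutually absolutely continuous.  Every nonempty class of all distributions sharing
   a common support has this form (take M to be one of its members). *)
definition distributions :: "'a measure \<Rightarrow> 'a measure set" where
  "distributions M = {P. prob_space P \<and> sets P = sets M \<and>
     absolutely_continuous M P \<and> absolutely_continuous P M}"

(* (Q - P) t + P *)
definition mixture :: "'a measure \<Rightarrow> 'a measure \<Rightarrow> real \<Rightarrow> 'a measure" where
  "mixture P Q t = measure_of (space P) (sets P)
     (\<lambda>A. ennreal (1 - t) * emeasure P A + ennreal t * emeasure Q A)"

(* Nonnegativity is carried by the codomain ennreal = [0, \<infinity>].  A divergence is a total function,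
   but only its values on S are constrained. *)
definition divergence_on :: "'a measure set \<Rightarrow> ('a measure \<Rightarrow> 'a measure \<Rightarrow> ennreal) \<Rightarrow> bool" where
  "divergence_on S D \<longleftrightarrow> (\<forall>P\<in>S. \<forall>Q\<in>S. D P Q = 0 \<longleftrightarrow> P = Q)"

(* mixture Q2 Q1 l = l Q1 + (1 - l) Q2 *)
definition right_convex_on :: "'a measure set \<Rightarrow> ('a measure \<Rightarrow> 'a measure \<Rightarrow> ennreal) \<Rightarrow> bool" where
  "right_convex_on S D \<longleftrightarrow> (\<forall>P\<in>S. \<forall>Q1\<in>S. \<forall>Q2\<in>S. \<forall>l\<in>{0..1::real}.
     ennreal l * D P Q1 + ennreal (1 - l) * D P Q2 \<ge> D P (mixture Q2 Q1 l))"

(* The integrand is [0, \<infinity>]-valued, so integrability means measurability and a finite integral.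
   At the null point s = 0 the quotient takes a conventional value. *)
definition Psi_integrable_on :: "'a measure set \<Rightarrow> ('a measure \<Rightarrow> 'a measure \<Rightarrow> ennreal) \<Rightarrow> bool" where
  "Psi_integrable_on S D \<longleftrightarrow> (\<forall>P\<in>S. \<forall>Q\<in>S.
     (\<lambda>s. D P (mixture P Q s) / ennreal s) \<in> borel_measurable (lebesgue_on {0..1}) \<and>
     (\<integral>\<^sup>+ s. D P (mixture P Q s) / ennreal s \<partial>lebesgue_on {0..1}) < \<infinity>)"

(* The integral up to 1, as a function of (P, Q); Psi_mixture below gives its value at
   (P, R(t)) as the integral up to t. *)
definition Psi :: "('a measure \<Rightarrow> 'a measure \<Rightarrow> ennreal) \<Rightarrow> 'a measure \<Rightarrow> 'a measure \<Rightarrow> ennreal" where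
  "Psi D P Q = (\<integral>\<^sup>+ s. D P (mixture P Q s) / ennreal s \<partial>lebesgue_on {0..1})"

lemma space_mixture [simp]: "space (mixture P Q t) = space P"
  and sets_mixture [simp]: "sets (mixture P Q t) = sets P"
  by (simp_all add: mixture_def)

lemma emeasure_mixture:
  assumes "sets Q = sets P"
  shows "emeasure (mixture P Q t) A = ennreal (1 - t) * emeasure P A + ennreal t * emeasure Q A"
proof (cases "A \<in> sets P")
  case True
  have "countably_additive (sets P)
      (\<lambda>A. ennreal (1 - t) * emeasure P A + ennreal t * emeasure Q A)"
    unfolding countably_additive_def
  proof (intro allI impI)
    fix F :: "nat \<Rightarrow> 'a set"
    assume "range F \<subseteq> sets P" "disjoint_family F"
    then have "(\<Sum>i. emeasure P (F i)) = emeasure P (\<Union>i. F i)"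
      "(\<Sum>i. emeasure Q (F i)) = emeasure Q (\<Union>i. F i)"
      using assms by (auto intro!: suminf_emeasure)
    then show "(\<Sum>i. ennreal (1 - t) * emeasure P (F i) + ennreal t * emeasure Q (F i)) =
        ennreal (1 - t) * emeasure P (\<Union>i. F i) + ennreal t * emeasure Q (\<Union>i. F i)"
      by (subst suminf_add[symmetric]) (simp_all only: summableI ennreal_suminf_cmult)
  qed
  then show ?thesis
    unfolding mixture_def using True
    by (intro emeasure_measure_of_sigma) (auto simp: positive_def sets.sigma_algebra_axioms)
next
  case False
  then show ?thesis
    using assms by (simp add: emeasure_notin_sets)
qed

lemma mixture_0: "sets Q = sets P \<Longrightarrow> mixture P Q 0 = P"
  and mixture_1: "sets Q = sets P \<Longrightarrow> mixture P Q 1 = Q"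
  by (rule measure_eqI; simp add: emeasure_mixture)+

lemma mixture_mixture:
  assumes "sets Q = sets P" "s \<in> {0..1}" "t \<in> {0..1}"
  shows "mixture P (mixture P Q t) s = mixture P Q (s * t)"
proof (rule measure_eqI)
  fix A
  have "s * t \<le> 1"
    using assms by (simp add: mult_le_one)
  moreover have "1 - s * t = (1 - s) + s * (1 - t)"
    by (simp add: algebra_simps)
  ultimately have "ennreal (1 - s * t) = ennreal (1 - s) + ennreal s * ennreal (1 - t)"
    using assms by (simp only: ennreal_plus ennreal_mult atLeastAtMost_iff diff_ge_0_iff_ge mult_nonneg_nonneg)
  moreover have "ennreal (s * t) = ennreal s * ennreal t"
    using assms by (intro ennreal_mult) auto
  ultimately show "emeasure (mixture P (mixture P Q t) s) A = emeasure (mixture P Q (s * t)) A"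
    using assms(1) by (simp only: emeasure_mixture sets_mixture distrib_left distrib_right mult.assoc add.assoc)
qed simp

lemma mixture_in_distributions:
  assumes "P \<in> distributions M" "Q \<in> distributions M" "t \<in> {0..1}"
  shows "mixture P Q t \<in> distributions M"
proof -
  have sets: "sets Q = sets P" "sets P = sets M" "sets Q = sets M"
    using assms by (auto simp: distributions_def)
  have nullP: "emeasure P A = 0 \<longleftrightarrow> emeasure M A = 0" if "A \<in> sets M" for A
    using assms(1) that unfolding distributions_def absolutely_continuous_def null_sets_def by auto
  have nullQ: "emeasure Q A = 0 \<longleftrightarrow> emeasure M A = 0" if "A \<in> sets M" for A
    using assms(2) that unfolding distributions_def absolutely_continuous_def null_sets_def by auto
  have sp: "space Q = space P"
    using sets by (intro sets_eq_imp_space_eq) auto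
  have "emeasure P (space P) = 1" "emeasure Q (space P) = 1"
    using assms sp unfolding distributions_def
    by (auto dest!: prob_space.emeasure_space_1)
  then have "prob_space (mixture P Q t)"
    using assms sets by (intro prob_spaceI) (simp add: emeasure_mixture flip: ennreal_plus)
  moreover have "emeasure (mixture P Q t) A = 0 \<longleftrightarrow> emeasure M A = 0" if "A \<in> sets M" for A
    using that assms(3) sets nullP nullQ by (cases "t = 0") (auto simp: emeasure_mixture ennreal_eq_0_iff)
  ultimately show ?thesis
    using sets unfolding distributions_def absolutely_continuous_def null_sets_def by auto
qed

lemma Psi_mixture:
  assumes "divergence_on (distributions M) D" "Psi_integrable_on (distributions M) D"
    and PQ: "P \<in> distributions M" "Q \<in> distributions M" and t: "t \<in> {0..1}"
  shows "Psi D P (mixture P Q t) =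
    (\<integral>\<^sup>+ s. D P (mixture P Q s) / ennreal s \<partial>lebesgue_on {0..t})"
proof -
  have sets: "sets Q = sets P"
    using PQ by (auto simp: distributions_def)
  define h where "h s = D P (mixture P Q s) / ennreal s" for s
  show ?thesis
  proof (cases "t = 0")
    case True
    have "mixture P P s = P" if "s \<in> {0..1}" for s
      using that
      by (intro measure_eqI) (auto simp: emeasure_mixture simp flip: distrib_right ennreal_plus)
    moreover have "D P P = 0"
      using assms by (auto simp: divergence_on_def)
    ultimately have "Psi D P (mixture P Q t) = (\<integral>\<^sup>+ s. 0 \<partial>lebesgue_on {0..1::real})"
      unfolding Psi_def using True sets by (intro nn_integral_cong) (simp add: mixture_0)
    also have "\<dots> = (\<integral>\<^sup>+ s. h s * indicator {0} s \<partial>lebesgue)"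
      by (subst nn_integral_null_set) auto
    finally show ?thesis
      using True by (simp add: h_def nn_integral_restrict_space)
  next
    case False
    then have t0: "t > 0" using t by simp
    define g where "g s = h s * indicator {0..1} s" for s
    have "h \<in> borel_measurable (lebesgue_on {0..1})"
      using assms unfolding Psi_integrable_on_def h_def by blast
    then have g: "g \<in> borel_measurable lebesgue"
      unfolding g_def by (subst (asm) borel_measurable_restrict_space_iff_ennreal) auto
    define k where "k s = g s * indicator {0..t} s" for s
    have k: "k \<in> borel_measurable lebesgue"
      unfolding k_def by (intro borel_measurable_times_ennreal borel_measurable_indicator g) simp
    have m: "(\<lambda>x::real. t * x) \<in> measurable lebesgue lebesgue"
      using lebesgue_measurable_scaling[of t, where ?'a = real] by (simp only: real_scaleR_def[abs_def])
    have "(\<integral>\<^sup>+ s. k s \<partial>lebesgue) = (\<integral>\<^sup>+ s. ennreal t * k s \<partial>distr lebesgue lebesgue (\<lambda>x. t * x))"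
      using t0 k by (subst lebesgue_real_scale[of t]) (simp_all add: nn_integral_density)
    also have "\<dots> = (\<integral>\<^sup>+ s. ennreal t * k (t * s) \<partial>lebesgue)"
      using m k by (subst nn_integral_distr) auto
    also have "\<dots> = (\<integral>\<^sup>+ s. D P (mixture P (mixture P Q t) s) / ennreal s * indicator {0..1} s \<partial>lebesgue)"
    proof (intro nn_integral_cong_AE)
      have "AE s in lebesgue. s \<noteq> (0::real)"
        by (rule AE_I[where N = "{0}"]) auto
      then show "AE s in lebesgue. ennreal t * k (t * s) =
          D P (mixture P (mixture P Q t) s) / ennreal s * indicator {0..1} s"
      proof eventually_elim
        case (elim s)
        show ?case
        proof (cases "s \<in> {0..1}")
          case True
          then have s: "s > 0" "s \<le> 1" using elim by auto
          then have ts: "t * s \<in> {0..t}" "t * s \<in> {0..1}"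
            using t t0 by (auto simp: mult_le_one)
          have "ennreal t * (x / ennreal (t * s)) = x / ennreal s" for x
          proof -
            have "inverse (ennreal (t * s)) = ennreal (inverse t) * ennreal (inverse s)"
              using s t0 by (simp add: inverse_ennreal flip: ennreal_mult)
            moreover have "ennreal t * ennreal (inverse t) = 1"
              using t0 by (simp flip: ennreal_mult)
            moreover have "ennreal t * (x * (ennreal (inverse t) * ennreal (inverse s))) =
                (ennreal t * ennreal (inverse t)) * (x * ennreal (inverse s))"
              by (simp only: ac_simps)
            ultimately show ?thesis
              using s by (simp add: divide_ennreal_def inverse_ennreal)
          qed
          then show ?thesis
            using True ts t sets
            by (simp add: k_def g_def h_def mixture_mixture mult.commute[of s t])
        next
          case False
          then have "t * s \<notin> {0..t}"
            using t0 by (auto simp: zero_le_mult_iff)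
          then show ?thesis
            using False by (simp add: k_def)
        qed
      qed
    qed
    also have "\<dots> = Psi D P (mixture P Q t)"
      unfolding Psi_def by (subst nn_integral_restrict_space) auto
    finally have "Psi D P (mixture P Q t) = (\<integral>\<^sup>+ s. k s \<partial>lebesgue)" ..
    also have "\<dots> = (\<integral>\<^sup>+ s. h s * indicator {0..t} s \<partial>lebesgue)"
      using t by (intro nn_integral_cong) (auto simp: k_def g_def indicator_def)
    finally show ?thesis
      by (simp add: h_def nn_integral_restrict_space)
  qed
qed

end

theory Submission
  imports Defs
begin

text \<open>
  Everything rests on one consequence of right-convexity. Write \<open>R s = mixture P Q s\<close>.
  The segment from \<open>P\<close> to \<open>Q\<close> starts at a zero of \<open>D P\<close>, so convexity along it gives
  \<open>D P (R s) \<le> s * D P Q\<close>; reparametrizing the segment,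
  \<open>D P (R s) \<le> (s / t) * D P (R t)\<close> for \<open>s \<le> t\<close>.

  The first form bounds the integrand \<open>D P (R s) / s\<close> of \<open>Psi D P Q\<close> by the constant
  \<open>D P Q\<close>, whence \<open>Psi D \<le> D\<close>. This is the decrease of the sequence, and also the reason why the
  hypothesis of integrability passes from \<open>D\<close> to \<open>Psi D\<close>: the integrand for \<open>Psi D\<close> is dominated by
  the one for \<open>D\<close>, and it is measurable because \<open>Psi D P (R s)\<close> is monotone in \<open>s\<close>, by the second
  form applied to \<open>Psi D\<close>. Right-convexity passes to \<open>Psi D\<close> because contracting towards \<open>P\<close>
  commutes with mixing, so that the convexity inequality holds pointwise under the integral. If
  \<open>Psi D P Q = 0\<close>, then \<open>D P (R s) = 0\<close> for some \<open>s > 0\<close>, which puts \<open>R s\<close>, and hence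
  \<open>Q\<close>, at \<open>P\<close>.

  Strict monotonicity needs one application of \<open>Psi\<close> because integrability makes
  \<open>Psi D\<close> finite: for \<open>0 < Psi D P (R t) < \<infinity>\<close> and \<open>s < t\<close> the factor \<open>s / t < 1\<close> in
  the second form makes the inequality strict.
\<close>

section \<open>Mixtures\<close>

lemma sets_eq_if_distributions:
  assumes "P \<in> distributions M" "Q \<in> distributions M"
  shows "sets Q = sets P"
  using assms by (auto simp: distributions_def)

lemma ennreal_complement_add:
  assumes "t \<in> {0..1}"
  shows "ennreal (1 - t) + ennreal t = 1"
  using assms by (simp flip: ennreal_plus)

lemma mixture_same:
  assumes "t \<in> {0..1}"
  shows "mixture P P t = P"
  using assms
  by (intro measure_eqI) (auto simp: emeasure_mixture ennreal_complement_add simp flip: distrib_right)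

lemma mixture_eq_left_imp_eq:
  assumes P: "P \<in> distributions M" and Q: "Q \<in> distributions M"
    and t: "0 < t" "t \<le> 1" and eq: "mixture P Q t = P"
  shows "P = Q"
proof (rule measure_eqI)
  show sets: "sets P = sets Q"
    using sets_eq_if_distributions[OF Q P] .
  fix A
  have "prob_space P"
    using P by (simp add: distributions_def)
  then have fin: "emeasure P A \<noteq> \<infinity>"
    by (simp add: finite_measure.emeasure_finite prob_space_def)
  have "ennreal (1 - t) * emeasure P A + ennreal t * emeasure Q A = emeasure P A"
    using emeasure_mixture[OF sets[symmetric], of t A] eq by simp
  also have "\<dots> = (ennreal (1 - t) + ennreal t) * emeasure P A"
    using t by (simp add: ennreal_complement_add)
  finally have "ennreal t * emeasure Q A = ennreal t * emeasure P A"
    using fin by (simp add: distrib_right ennreal_add_left_cancel ennreal_mult_eq_top_iff)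
  then show "emeasure P A = emeasure Q A"
    using t by (simp add: ennreal_mult_cancel_left)
qed

text \<open>
  Contraction towards \<open>P\<close> is an affine map on distributions; this is what lets convexity survive
  under the integral that defines \<open>Psi\<close>.
\<close>

lemma mixture_mixture_right:
  assumes "sets Q1 = sets P" "sets Q2 = sets P" "l \<in> {0..1}"
  shows "mixture P (mixture Q2 Q1 l) s = mixture (mixture P Q2 s) (mixture P Q1 s) l"
proof (rule measure_eqI)
  fix A
  let ?p = "ennreal (1 - s) * emeasure P A"
  have p: "?p = ennreal (1 - l) * ?p + ennreal l * ?p"
    using assms(3) by (simp add: ennreal_complement_add flip: distrib_right)
  have "emeasure (mixture P (mixture Q2 Q1 l) s) A =
      ?p + ennreal s * (ennreal (1 - l) * emeasure Q2 A + ennreal l * emeasure Q1 A)"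
    using assms by (simp add: emeasure_mixture)
  also have "\<dots> = (ennreal (1 - l) * ?p + ennreal l * ?p) +
      ennreal s * (ennreal (1 - l) * emeasure Q2 A + ennreal l * emeasure Q1 A)"
    by (subst p) (rule refl)
  also have "\<dots> = ennreal (1 - l) * (?p + ennreal s * emeasure Q2 A) +
      ennreal l * (?p + ennreal s * emeasure Q1 A)"
    by (simp add: distrib_left ac_simps)
  also have "\<dots> = emeasure (mixture (mixture P Q2 s) (mixture P Q1 s) l) A"
    using assms by (simp add: emeasure_mixture)
  finally show "emeasure (mixture P (mixture Q2 Q1 l) s) A =
      emeasure (mixture (mixture P Q2 s) (mixture P Q1 s) l) A" .
qed simp

section \<open>Right-convex divergences along a segment\<close>

lemma right_convex_divergence_mixture_le:
  assumes div: "divergence_on (distributions M) D" and conv: "right_convex_on (distributions M) D"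
    and PQ: "P \<in> distributions M" "Q \<in> distributions M" and s: "s \<in> {0..1}"
  shows "D P (mixture P Q s) \<le> ennreal s * D P Q"
proof -
  have "D P (mixture P Q s) \<le> ennreal s * D P Q + ennreal (1 - s) * D P P"
    using conv PQ s unfolding right_convex_on_def by blast
  moreover have "D P P = 0"
    using div PQ(1) unfolding divergence_on_def by blast
  ultimately show ?thesis by simp
qed

lemma right_convex_divergence_mixture_ratio_le:
  assumes div: "divergence_on (distributions M) D" and conv: "right_convex_on (distributions M) D"
    and PQ: "P \<in> distributions M" "Q \<in> distributions M"
    and st: "0 \<le> s" "s \<le> t" "0 < t" "t \<le> 1"
  shows "D P (mixture P Q s) \<le> ennreal (s / t) * D P (mixture P Q t)"
proof -
  have r: "s / t \<in> {0..1}" and t: "t \<in> {0..1}"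
    using st by auto
  have "mixture P (mixture P Q t) (s / t) = mixture P Q s"
    using mixture_mixture[OF sets_eq_if_distributions[OF PQ] r t] st by simp
  then show ?thesis
    using right_convex_divergence_mixture_le[OF div conv PQ(1) mixture_in_distributions[OF PQ t] r]
    by simp
qed

lemma right_convex_divergence_mixture_mono:
  assumes div: "divergence_on (distributions M) D" and conv: "right_convex_on (distributions M) D"
    and PQ: "P \<in> distributions M" "Q \<in> distributions M"
    and st: "0 \<le> s" "s \<le> t" "t \<le> 1"
  shows "D P (mixture P Q s) \<le> D P (mixture P Q t)"
proof (cases "t = 0")
  case False
  then have t: "0 < t" using st by simp
  have "D P (mixture P Q s) \<le> ennreal (s / t) * D P (mixture P Q t)"
    using right_convex_divergence_mixture_ratio_le[OF div conv PQ st(1,2) t st(3)] .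
  also have "\<dots> \<le> 1 * D P (mixture P Q t)"
    using st t by (intro mult_right_mono) auto
  finally show ?thesis by simp
qed (use st in simp)

section \<open>Properties preserved by the integral operator\<close>

text \<open>
  At \<open>s = 0\<close> the quotient is \<open>0 / 0 = 0\<close>, so the integrand is bounded by \<open>D P Q\<close> on all of
  the unit interval, which has measure one.
\<close>

lemma Psi_le:
  assumes div: "divergence_on (distributions M) D" and conv: "right_convex_on (distributions M) D"
    and PQ: "P \<in> distributions M" "Q \<in> distributions M"
  shows "Psi D P Q \<le> D P Q"
proof -
  have "Psi D P Q \<le> (\<integral>\<^sup>+ s. D P Q \<partial>lebesgue_on {0..1::real})"
    unfolding Psi_def
  proof (rule nn_integral_mono)
    fix s :: real
    assume "s \<in> space (lebesgue_on {0..1})"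
    then have s: "s \<in> {0..1}" by simp
    have le: "D P (mixture P Q s) \<le> ennreal s * D P Q"
      using right_convex_divergence_mixture_le[OF div conv PQ s] .
    show "D P (mixture P Q s) / ennreal s \<le> D P Q"
    proof (cases "s = 0")
      case True
      then show ?thesis
        using le by simp
    next
      case False
      then show ?thesis
        using le s by (intro divide_le_posI_ennreal) auto
    qed
  qed
  also have "\<dots> = D P Q"
    by (simp add: emeasure_restrict_space)
  finally show ?thesis .
qed

lemma divergence_on_Psi:
  assumes div: "divergence_on (distributions M) D" and int: "Psi_integrable_on (distributions M) D"
  shows "divergence_on (distributions M) (Psi D)"
  unfolding divergence_on_def
proof (intro ballI iffI)
  fix P Q
  assume PQ: "P \<in> distributions M" "Q \<in> distributions M"
  {
    assume "P = Q"
    then have "D P (mixture P Q s) = 0" if "s \<in> {0..1}" for s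
      using that div PQ by (simp add: mixture_same divergence_on_def)
    then have "Psi D P Q = (\<integral>\<^sup>+ s. 0 \<partial>lebesgue_on {0..1::real})"
      unfolding Psi_def by (intro nn_integral_cong) simp
    then show "Psi D P Q = 0" by simp
  next
    assume zero: "Psi D P Q = 0"
    let ?f = "\<lambda>s. D P (mixture P Q s) / ennreal s"
    have "?f \<in> borel_measurable (lebesgue_on {0..1})"
      using int PQ by (simp add: Psi_integrable_on_def)
    then have "AE s in lebesgue_on {0..1}. ?f s = 0"
      using zero unfolding Psi_def by (simp add: nn_integral_0_iff_AE)
    then have ae: "AE s in lebesgue. s \<in> {0..1} \<longrightarrow> ?f s = 0"
      by (subst (asm) AE_restrict_space_iff) auto
    have "\<exists>s. 0 < s \<and> s \<le> 1 \<and> ?f s = 0"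
    proof (rule ccontr)
      assume none: "\<not> ?thesis"
      have "AE s in lebesgue. s \<notin> {0<..1::real}"
        using ae by eventually_elim (use none in auto)
      then have "emeasure lebesgue {0<..1::real} = 0"
        by (rule AE_iff_measurable[THEN iffD1, rotated 2]) auto
      then show False by simp
    qed
    then obtain s where s: "0 < s" "s \<le> 1" and "?f s = 0"
      by blast
    then have "D P (mixture P Q s) = 0"
      by (simp add: divide_ennreal_def)
    moreover have "mixture P Q s \<in> distributions M"
      using PQ s by (intro mixture_in_distributions) auto
    ultimately have "mixture P Q s = P"
      using div PQ by (metis divergence_on_def)
    then show "P = Q"
      using mixture_eq_left_imp_eq[OF PQ s] by simp
  }
qed

lemma right_convex_on_Psi:
  assumes conv: "right_convex_on (distributions M) D" and int: "Psi_integrable_on (distributions M) D"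
  shows "right_convex_on (distributions M) (Psi D)"
  unfolding right_convex_on_def
proof (intro ballI)
  fix P Q1 Q2 and l :: real
  assume P: "P \<in> distributions M" and Q1: "Q1 \<in> distributions M" and Q2: "Q2 \<in> distributions M"
    and l: "l \<in> {0..1}"
  let ?f = "\<lambda>Q s. D P (mixture P Q s) / ennreal s"
  have [measurable]: "?f Q1 \<in> borel_measurable (lebesgue_on {0..1})"
    "?f Q2 \<in> borel_measurable (lebesgue_on {0..1})"
    using int P Q1 Q2 by (auto simp: Psi_integrable_on_def)
  have "Psi D P (mixture Q2 Q1 l) \<le>
      (\<integral>\<^sup>+ s. ennreal l * ?f Q1 s + ennreal (1 - l) * ?f Q2 s \<partial>lebesgue_on {0..1})"
    unfolding Psi_def
  proof (rule nn_integral_mono)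
    fix s :: real
    assume "s \<in> space (lebesgue_on {0..1})"
    then have s: "s \<in> {0..1}" by simp
    have "D P (mixture P (mixture Q2 Q1 l) s) = D P (mixture (mixture P Q2 s) (mixture P Q1 s) l)"
      using mixture_mixture_right[OF sets_eq_if_distributions[OF P Q1] sets_eq_if_distributions[OF P Q2] l]
      by simp
    also have "\<dots> \<le> ennreal l * D P (mixture P Q1 s) + ennreal (1 - l) * D P (mixture P Q2 s)"
      using conv P l mixture_in_distributions[OF P Q1 s] mixture_in_distributions[OF P Q2 s]
      unfolding right_convex_on_def by blast
    finally show "D P (mixture P (mixture Q2 Q1 l) s) / ennreal s \<le>
        ennreal l * ?f Q1 s + ennreal (1 - l) * ?f Q2 s"
      by (auto dest: divide_right_mono_ennreal[where c = "ennreal s"]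
          simp: add_divide_distrib_ennreal ennreal_times_divide)
  qed
  also have "\<dots> = ennreal l * Psi D P Q1 + ennreal (1 - l) * Psi D P Q2"
    unfolding Psi_def by (simp add: nn_integral_add nn_integral_cmult)
  finally show "Psi D P (mixture Q2 Q1 l) \<le> ennreal l * Psi D P Q1 + ennreal (1 - l) * Psi D P Q2" .
qed

text \<open>A sublevel set of a monotone function is an interval, hence Borel.\<close>

lemma borel_measurable_mono_linorder:
  fixes f :: "real \<Rightarrow> 'b::{linorder_topology, second_countable_topology}"
  assumes "mono f"
  shows "f \<in> borel_measurable borel"
proof (rule borel_measurableI_less)
  fix y
  have "is_interval {x. f x < y}"
    unfolding is_interval_1 using assms by (auto dest: monoD intro: le_less_trans)
  then show "{x \<in> space borel. f x < y} \<in> sets borel"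
    by (simp add: real_interval_borel_measurable)
qed

lemma Psi_integrable_on_Psi:
  assumes div: "divergence_on (distributions M) D" and conv: "right_convex_on (distributions M) D"
    and int: "Psi_integrable_on (distributions M) D"
  shows "Psi_integrable_on (distributions M) (Psi D)"
  unfolding Psi_integrable_on_def
proof (intro ballI conjI)
  fix P Q
  assume PQ: "P \<in> distributions M" "Q \<in> distributions M"
  \<comment> \<open>Monotonicity is known on the unit interval only; clamping the argument extends it to the line.\<close>
  define F where "F s = Psi D P (mixture P Q (max 0 (min 1 s)))" for s
  have "mono F"
    unfolding F_def
    by (intro monoI right_convex_divergence_mixture_mono[OF divergence_on_Psi[OF div int]
          right_convex_on_Psi[OF conv int] PQ]) auto
  then have "F \<in> borel_measurable borel"
    by (rule borel_measurable_mono_linorder)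
  then have "(\<lambda>s. F s / ennreal s) \<in> borel_measurable borel"
    by measurable
  then have "(\<lambda>s. F s / ennreal s) \<in> borel_measurable (lebesgue_on {0..1})"
    by (intro measurable_restrict_space1 measurable_completion) simp
  then show "(\<lambda>s. Psi D P (mixture P Q s) / ennreal s) \<in> borel_measurable (lebesgue_on {0..1})"
    by (rule measurable_cong[THEN iffD1, rotated]) (simp add: F_def)
  have "(\<integral>\<^sup>+ s. Psi D P (mixture P Q s) / ennreal s \<partial>lebesgue_on {0..1}) \<le>
      (\<integral>\<^sup>+ s. D P (mixture P Q s) / ennreal s \<partial>lebesgue_on {0..1})"
    using PQ
    by (intro nn_integral_mono divide_right_mono_ennreal Psi_le[OF div conv] mixture_in_distributions)
      auto
  also have "\<dots> < \<infinity>"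
    using int PQ by (simp add: Psi_integrable_on_def)
  finally show "(\<integral>\<^sup>+ s. Psi D P (mixture P Q s) / ennreal s \<partial>lebesgue_on {0..1}) < \<infinity>" .
qed

section \<open>Strict growth and iteration\<close>

lemma strict_mono_on_Psi_mixture:
  assumes div: "divergence_on (distributions M) D" and conv: "right_convex_on (distributions M) D"
    and int: "Psi_integrable_on (distributions M) D"
    and PQ: "P \<in> distributions M" "Q \<in> distributions M" and ne: "P \<noteq> Q"
  shows "strict_mono_on {0..1} (\<lambda>t. Psi D P (mixture P Q t))"
proof (rule strict_mono_onI)
  fix s t :: real
  assume "s \<in> {0..1}" "t \<in> {0..1}" "s < t"
  then have st: "0 \<le> s" "s < t" "t \<le> 1" "0 < t" "t \<in> {0..1}" by auto
  note divPsi = divergence_on_Psi[OF div int]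
  have R: "mixture P Q t \<in> distributions M"
    using mixture_in_distributions[OF PQ st(5)] .
  have "mixture P Q t \<noteq> P"
    using mixture_eq_left_imp_eq[OF PQ st(4) st(3)] ne by auto
  then have pos: "0 < Psi D P (mixture P Q t)"
    using divPsi PQ(1) R by (metis divergence_on_def not_gr_zero)
  have fin: "Psi D P (mixture P Q t) < top"
    using int PQ(1) R unfolding Psi_integrable_on_def Psi_def by simp
  have "Psi D P (mixture P Q s) \<le> ennreal (s / t) * Psi D P (mixture P Q t)"
    using st by (intro right_convex_divergence_mixture_ratio_le[OF divPsi
          right_convex_on_Psi[OF conv int] PQ]) auto
  also have "\<dots> < 1 * Psi D P (mixture P Q t)"
    using st pos fin by (intro ennreal_mult_strict_right_mono) (auto simp: ennreal_less_one_iff)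
  finally show "Psi D P (mixture P Q s) < Psi D P (mixture P Q t)" by simp
qed

lemma Psi_iterate:
  assumes "divergence_on (distributions M) D" "right_convex_on (distributions M) D"
    "Psi_integrable_on (distributions M) D"
  shows "divergence_on (distributions M) ((Psi ^^ k) D)" (is "?div k")
    and "right_convex_on (distributions M) ((Psi ^^ k) D)" (is "?conv k")
    and "Psi_integrable_on (distributions M) ((Psi ^^ k) D)" (is "?int k")
proof -
  have "?div k \<and> ?conv k \<and> ?int k"
    by (induction k)
      (simp_all add: assms divergence_on_Psi right_convex_on_Psi Psi_integrable_on_Psi)
  then show "?div k" "?conv k" "?int k" by auto
qed

theorem theorem2:
  fixes M :: "'a measure"
    and D :: "'a measure \<Rightarrow> 'a measure \<Rightarrow> ennreal"
  assumes "divergence_on (distributions M) D"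
    and "right_convex_on (distributions M) D"
    and "Psi_integrable_on (distributions M) D"
  shows "(\<forall>k\<ge>1. Psi_integrable_on (distributions M) ((Psi ^^ k) D) \<and>
             divergence_on (distributions M) ((Psi ^^ k) D) \<and>
             right_convex_on (distributions M) ((Psi ^^ k) D)) \<and>
         (\<forall>P\<in>distributions M. \<forall>Q\<in>distributions M. \<forall>t\<in>{0..1}.
             decseq (\<lambda>k. (Psi ^^ k) D P (mixture P Q t)) \<and>
             (\<forall>k. (Psi ^^ k) D P (mixture P Q t) \<ge> 0)) \<and>
         (\<forall>P\<in>distributions M. \<forall>Q\<in>distributions M. P \<noteq> Q \<longrightarrow>
             (\<forall>k\<ge>1. strict_mono_on {0..1} (\<lambda>t. (Psi ^^ k) D P (mixture P Q t))))"
proof (intro conjI ballI allI impI)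
  fix P Q and t :: real
  assume PQ: "P \<in> distributions M" "Q \<in> distributions M" and "t \<in> {0..1}"
  then show "decseq (\<lambda>k. (Psi ^^ k) D P (mixture P Q t))"
    using Psi_le[OF Psi_iterate(1,2)[OF assms]]
    by (intro decseq_SucI) (simp add: mixture_in_distributions)
next
  fix P Q and k :: nat
  assume PQ: "P \<in> distributions M" "Q \<in> distributions M" and ne: "P \<noteq> Q" and "1 \<le> k"
  then obtain j where "k = Suc j"
    by (cases k) auto
  then show "strict_mono_on {0..1} (\<lambda>t. (Psi ^^ k) D P (mixture P Q t))"
    using strict_mono_on_Psi_mixture[OF Psi_iterate[OF assms, of j] PQ ne] by simp
qed (simp_all add: Psi_iterate[OF assms])

end
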